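(* Let $\tilde F_i:\tilde X\to Y$, $i=0,\dots,r_{\mathrm{num}}-1$, be the linear MRI operators described in the context, let $\mathcal P_0\in\tilde X$ and $\rho>0$, and let $\mathcal M_0,\dots,\mathcal M_{r_{\mathrm{num}}-1}\in Y$. Assume there exists $\mathcal P^*\in B_{\rho/2}(\mathcal P_0)$ with $\tilde F_i(\mathcal P^* )=\mathcal M_i$ for all $i=0,\dots,r_{\mathrm{num}}-1$. Assume the data are exact, i.e. $\mathcal M_i^\delta=\mathcal M_i$ and $\delta_i=0$ for all $i$. Then the sequence $(\mathcal P_k^\delta)_{k\ge 0}$ generated from $\mathcal P_0$ by the loping Steepest-Descent Kaczmarz (lSDK) iteration converges, as $k\to\infty$, to a solution of the system $\tilde F_i(\mathcal P)=\mathcal M_i$, $i=0,\dots,r_{\mathrm{num}}-1$.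
   Context: Discrete MRI model. Let $p_{\mathrm{hor}},p_{\mathrm{ver}},r_{\mathrm{num}},b_{\mathrm{num}}$ be positive integers, $p_{\mathrm{num}}=p_{\mathrm{hor}}p_{\mathrm{ver}}$, and $\mathbb B=\{1,\dots,p_{\mathrm{hor}}\}\times\{1,\dots,p_{\mathrm{ver}}\}$, identified via a fixed enumeration with $\{0,\dots,p_{\mathrm{num}}-1\}$. Let $\mathbb M\subset\mathbb B$ be a given subset. Let $\tilde X=\{f\mid f:\mathbb B\to\mathbb C\}$ and $Y=\{g\mid g:\mathbb M\to\mathbb C\}$, with Euclidean norms $\|\cdot\|$ and inner products. The discrete Fourier transform $\mathcal F:\tilde X\to\tilde X$ is $(\mathcal F f)(m)=\sum_{n=0}^{p_{\mathrm{num}}-1}f(n)\exp(-2\pi i\,nm/p_{\mathrm{num}})$, and $\mathbf P:\tilde X\to Y$ is restriction, $(\mathbf P[f])(m)=f(m)$ for $m\in\mathbb M$. Let $\mathcal B_n:\mathbb B\to\mathbb C$ ($n=1,\dots,b_{\mathrm{num}}$) be given basis functions and $b_{j,n}\in\mathbb C$ ($j=0,\dots,r_{\mathrm{num}}-1$) known coefficients. Define the linear operators $$\tilde F_i(\mathcal P)=\sum_{n=1}^{b_{\mathrm{num}}}b_{i,n}\,\mathbf P[\mathcal F(\mathcal P\times\mathcal B_n)],\qquad i=0,\dots,r_{\mathrm{num}}-1,$$ where $\times$ is the pointwise product. $\tilde F_i^*$ denotes the adjoint and $B_r(\cdot)$ the ball of radius $r$. Data. $\mathcal M_i\in Y$ denote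 exact data and $\mathcal M_i^\delta\in Y$ measured data with $\|\mathcal M_i^\delta-\mathcal M_i\|\le\delta_i$. lSDK iteration. Fix $\tau>2$ and put $[k]=k \bmod r_{\mathrm{num}}\in\{0,\dots,r_{\mathrm{num}}-1\}$. Starting with $\mathcal P_0^\delta=\mathcal P_0$, set $$\mathcal P_{k+1}^\delta=\mathcal P_k^\delta-\omega_k\alpha_k s_k,\qquad s_k=\tilde F_{[k]}^*\big(\tilde F_{[k]}(\mathcal P_k^\delta)-\mathcal M_{[k]}^\delta\big),$$ where $\omega_k=1$ if $\|\tilde F_{[k]}(\mathcal P_k^\delta)-\mathcal M_{[k]}^\delta\|>\tau\delta_{[k]}$ and $\omega_k=0$ otherwise, and $\alpha_k=\|s_k\|^2/\|\tilde F_{[k]}s_k\|^2$ if $\omega_k=1$, $\alpha_k=1$ if $\omega_k=0$. *)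

theory Defs
  imports "HOL-Analysis.Analysis"
begin

text \<open>
  The space of functions from a finite set \<open>A\<close> to the complex numbers is
  \<open>A \<rightarrow>\<^sub>E UNIV\<close>: functions are \<open>undefined\<close> outside \<open>A\<close>, so that HOL equality is equality on \<open>A\<close>.
\<close>

type_synonym pixel = "nat \<times> nat"

definition cfuns :: "'a set \<Rightarrow> ('a \<Rightarrow> complex) set" where
  "cfuns A = A \<rightarrow>\<^sub>E UNIV"

definition cinner_on :: "'a set \<Rightarrow> ('a \<Rightarrow> complex) \<Rightarrow> ('a \<Rightarrow> complex) \<Rightarrow> complex" where
  "cinner_on A f g = (\<Sum>x\<in>A. f x * cnj (g x))"

definition l2_norm :: "'a set \<Rightarrow> ('a \<Rightarrow> complex) \<Rightarrow> real" where
  "l2_norm A f = L2_set (\<lambda>x. cmod (f x)) A"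

definition l2_dist :: "'a set \<Rightarrow> ('a \<Rightarrow> complex) \<Rightarrow> ('a \<Rightarrow> complex) \<Rightarrow> real" where
  "l2_dist A f g = l2_norm A (\<lambda>x. f x - g x)"

text \<open>
  The description operator is proper whenever \<open>A\<close> and \<open>M\<close> are finite and \<open>T\<close> is linear from
  \<open>cfuns A\<close> to \<open>cfuns M\<close>, the case in which it is used.
\<close>

definition cadjoint_on ::
    "'a set \<Rightarrow> 'b set \<Rightarrow> (('a \<Rightarrow> complex) \<Rightarrow> 'b \<Rightarrow> complex) \<Rightarrow> ('b \<Rightarrow> complex) \<Rightarrow> 'a \<Rightarrow> complex" where
  "cadjoint_on A M T g =
     (THE h. h \<in> cfuns A \<and> (\<forall>f\<in>cfuns A. cinner_on M (T f) g = cinner_on A f h))"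

definition pixels :: "nat \<Rightarrow> nat \<Rightarrow> pixel set" where
  "pixels p_hor p_ver = {1..p_hor} \<times> {1..p_ver}"

text \<open>
  \<open>idx\<close> is the enumeration identifying the pixels with \<open>{0..<p_hor * p_ver}\<close>; the sum over
  \<open>n = 0, \<dots>, p_hor * p_ver - 1\<close> is written as a sum over pixels.
\<close>

definition dft :: "nat \<Rightarrow> nat \<Rightarrow> (pixel \<Rightarrow> nat) \<Rightarrow> (pixel \<Rightarrow> complex) \<Rightarrow> pixel \<Rightarrow> complex" where
  "dft p_hor p_ver idx f =
     (\<lambda>m\<in>pixels p_hor p_ver. \<Sum>n\<in>pixels p_hor p_ver.
        f n * exp (- 2 * of_real pi * \<i> * of_nat (idx n) * of_nat (idx m) / of_nat (p_hor * p_ver)))"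

text \<open>
  \<open>restrict _ M\<close> is the sampling operator onto \<open>M\<close>, \<open>Bas n\<close> are the basis functions and
  \<open>b i n\<close> their coefficients.
\<close>

definition mri_op ::
    "nat \<Rightarrow> nat \<Rightarrow> (pixel \<Rightarrow> nat) \<Rightarrow> pixel set \<Rightarrow> nat \<Rightarrow> (nat \<Rightarrow> pixel \<Rightarrow> complex) \<Rightarrow>
     (nat \<Rightarrow> nat \<Rightarrow> complex) \<Rightarrow> nat \<Rightarrow> (pixel \<Rightarrow> complex) \<Rightarrow> pixel \<Rightarrow> complex" where
  "mri_op p_hor p_ver idx M b_num Bas b i f =
     (\<lambda>m\<in>M. \<Sum>n = 1..b_num.
        b i n * restrict (dft p_hor p_ver idx (\<lambda>x\<in>pixels p_hor p_ver. f x * Bas n x)) M m)"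

text \<open>
  The operators \<open>T 0, \<dots>, T (r - 1)\<close> map \<open>cfuns A\<close> to \<open>cfuns M\<close>; \<open>g\<close> are the (measured) data
  and \<open>\<delta>\<close> the noise levels.
\<close>

definition lsdk_step ::
    "'a set \<Rightarrow> 'b set \<Rightarrow> nat \<Rightarrow> (nat \<Rightarrow> ('a \<Rightarrow> complex) \<Rightarrow> 'b \<Rightarrow> complex) \<Rightarrow>
     (nat \<Rightarrow> 'b \<Rightarrow> complex) \<Rightarrow> (nat \<Rightarrow> real) \<Rightarrow> real \<Rightarrow> nat \<Rightarrow> ('a \<Rightarrow> complex) \<Rightarrow> 'a \<Rightarrow> complex" where
  "lsdk_step A M r T g \<delta> \<tau> k P =
     (let j = k mod r;
          res = (\<lambda>m\<in>M. T j P m - g j m);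
          s = cadjoint_on A M (T j) res;
          \<omega> = (if l2_norm M res > \<tau> * \<delta> j then 1 else 0 :: real);
          \<alpha> = (if \<omega> = 1 then (l2_norm A s)\<^sup>2 / (l2_norm M (T j s))\<^sup>2 else 1)
      in (\<lambda>x\<in>A. P x - of_real (\<omega> * \<alpha>) * s x))"

primrec lsdk ::
    "'a set \<Rightarrow> 'b set \<Rightarrow> nat \<Rightarrow> (nat \<Rightarrow> ('a \<Rightarrow> complex) \<Rightarrow> 'b \<Rightarrow> complex) \<Rightarrow>
     (nat \<Rightarrow> 'b \<Rightarrow> complex) \<Rightarrow> (nat \<Rightarrow> real) \<Rightarrow> real \<Rightarrow> ('a \<Rightarrow> complex) \<Rightarrow> nat \<Rightarrow> 'a \<Rightarrow> complex" where
  "lsdk A M r T g \<delta> \<tau> P0 0 = P0"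
| "lsdk A M r T g \<delta> \<tau> P0 (Suc k) = lsdk_step A M r T g \<delta> \<tau> k (lsdk A M r T g \<delta> \<tau> P0 k)"

end

theory Submission
  imports Defs
begin

text \<open>
  With exact data the iteration is Fejer monotone: no step increases the distance to any solution.
  Write \<open>T\<close> for the operator of the current step, \<open>res\<close> for the residual, \<open>s = T* res\<close> and
  \<open>\<alpha> = \<parallel>s\<parallel>\<^sup>2 / \<parallel>T s\<parallel>\<^sup>2\<close>. If \<open>Z\<close> is a solution then \<open>res = T (P - Z)\<close>, so
  \<open>\<langle>P - Z, s\<rangle> = \<parallel>res\<parallel>\<^sup>2\<close>, and expanding the square gives
  \<open>\<parallel>P - \<alpha> s - Z\<parallel>\<^sup>2 = \<parallel>P - Z\<parallel>\<^sup>2 - 2 \<alpha> \<parallel>res\<parallel>\<^sup>2 + \<alpha>\<^sup>2 \<parallel>s\<parallel>\<^sup>2\<close>. By Cauchy--Schwarz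
  \<open>\<parallel>s\<parallel>\<^sup>2 = \<langle>T s, res\<rangle> \<le> \<parallel>T s\<parallel> \<parallel>res\<parallel>\<close>, that is \<open>\<alpha> \<parallel>s\<parallel>\<^sup>2 \<le> \<parallel>res\<parallel>\<^sup>2\<close>, so the squared distance
  drops by at least \<open>\<alpha> \<parallel>res\<parallel>\<^sup>2\<close>. This drop dominates both the squared step length
  \<open>\<alpha>\<^sup>2 \<parallel>s\<parallel>\<^sup>2\<close> (\<open>sd_step_length\<close>) and, since for \<open>res \<noteq> 0\<close> the step size \<open>\<alpha>\<close> is
  bounded below by the inverse square of a bound for \<open>T\<close>, a fixed multiple of \<open>\<parallel>res\<parallel>\<^sup>2\<close> (\<open>sd_step_residual\<close>).

  The squared distances decrease and are nonnegative, so the drops tend to zero. Hence the steps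
  and the residuals used in them tend to zero. As every equation is used once in each \<open>r\<close>
  consecutive steps, the residuals of all equations tend to zero along the whole sequence
  (\<open>residual_tendsto_0\<close>). The space is finite-dimensional and the sequence is bounded, so some
  subsequence converges; its limit solves the system, and Fejer monotonicity with respect to this
  particular solution upgrades convergence of the subsequence to convergence of the sequence
  (\<open>converges_to_solution\<close>).

  The argument applies to any finite family of operators given by matrices; the matrix of the
  composition of weighting by the basis functions, Fourier transform and sampling is computed in
  \<open>mri_op_eq_kernel_op\<close>.
\<close>

section \<open>The Euclidean norm on functions on a finite set\<close>

lemma l2_norm_nonneg [simp]: "0 \<le> l2_norm A f"
  by (simp add: l2_norm_def)

lemma l2_dist_nonneg [simp]: "0 \<le> l2_dist A f g"
  by (simp add: l2_dist_def)

lemma l2_norm_power2: "(l2_norm A f)\<^sup>2 = (\<Sum>x\<in>A. (cmod (f x))\<^sup>2)"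
  by (simp add: l2_norm_def L2_set_def sum_nonneg)

lemma l2_norm_power2_eq_cinner: "(l2_norm A f)\<^sup>2 = Re (cinner_on A f f)"
  by (simp only: l2_norm_power2 cinner_on_def cmod_power2) (simp add: power2_eq_square)

lemma l2_norm_cong: "(\<And>x. x \<in> A \<Longrightarrow> f x = g x) \<Longrightarrow> l2_norm A f = l2_norm A g"
  unfolding l2_norm_def by (rule L2_set_cong) auto

lemma cinner_on_cong:
  "(\<And>x. x \<in> A \<Longrightarrow> f x = f' x) \<Longrightarrow> (\<And>x. x \<in> A \<Longrightarrow> g x = g' x)
    \<Longrightarrow> cinner_on A f g = cinner_on A f' g'"
  by (simp add: cinner_on_def)

lemma cmod_le_l2_norm: "finite A \<Longrightarrow> x \<in> A \<Longrightarrow> cmod (f x) \<le> l2_norm A f"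
  unfolding l2_norm_def by (rule member_le_L2_set) auto

lemma l2_norm_eq_0_iff: "finite A \<Longrightarrow> l2_norm A f = 0 \<longleftrightarrow> (\<forall>x\<in>A. f x = 0)"
  by (simp add: l2_norm_def L2_set_eq_0_iff)

lemma cmod_sum_mult_le: "cmod (\<Sum>x\<in>A. f x * g x) \<le> l2_norm A f * l2_norm A g"
proof -
  have "cmod (\<Sum>x\<in>A. f x * g x) \<le> (\<Sum>x\<in>A. \<bar>cmod (f x)\<bar> * \<bar>cmod (g x)\<bar>)"
    by (rule order_trans[OF norm_sum]) (simp add: norm_mult)
  also have "\<dots> \<le> l2_norm A f * l2_norm A g"
    unfolding l2_norm_def by (rule L2_set_mult_ineq)
  finally show ?thesis .
qed

lemma Cauchy_Schwarz_cinner_on: "cmod (cinner_on A f g) \<le> l2_norm A f * l2_norm A g"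
  using cmod_sum_mult_le[where f = f and g = "\<lambda>x. cnj (g x)" and A = A]
  by (simp add: cinner_on_def l2_norm_def)

lemma l2_norm_triangle: "l2_norm A (\<lambda>x. f x + g x) \<le> l2_norm A f + l2_norm A g"
proof -
  have "l2_norm A (\<lambda>x. f x + g x) \<le> L2_set (\<lambda>x. cmod (f x) + cmod (g x)) A"
    unfolding l2_norm_def by (rule L2_set_mono) (auto simp: norm_triangle_ineq)
  also have "\<dots> \<le> l2_norm A f + l2_norm A g"
    unfolding l2_norm_def by (rule L2_set_triangle_ineq)
  finally show ?thesis .
qed

lemma l2_dist_triangle: "l2_dist A f h \<le> l2_dist A f g + l2_dist A g h"
  using l2_norm_triangle[of A "\<lambda>x. f x - g x" "\<lambda>x. g x - h x"] by (simp add: l2_dist_def)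

lemma l2_dist_commute: "l2_dist A f g = l2_dist A g f"
  by (simp add: l2_dist_def l2_norm_def norm_minus_commute)

lemma l2_norm_diff_scaled:
  "(l2_norm A (\<lambda>x. e x - of_real a * s x))\<^sup>2
    = (l2_norm A e)\<^sup>2 - 2 * a * Re (cinner_on A e s) + a\<^sup>2 * (l2_norm A s)\<^sup>2"
proof -
  have "(cmod (e x - of_real a * s x))\<^sup>2
      = (cmod (e x))\<^sup>2 - 2 * a * Re (e x * cnj (s x)) + a\<^sup>2 * (cmod (s x))\<^sup>2" for x
    unfolding cmod_power2 by (simp add: power2_eq_square algebra_simps)
  then show ?thesis
    by (simp only: l2_norm_power2 cinner_on_def sum.distrib sum_subtractf sum_distrib_left Re_sum)
qed

lemma l2_norm_scaled: "(l2_norm A (\<lambda>x. of_real a * s x))\<^sup>2 = a\<^sup>2 * (l2_norm A s)\<^sup>2"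
  by (simp add: l2_norm_power2 norm_mult power_mult_distrib sum_distrib_left)

lemma l2_dist_tendsto_0:
  assumes "\<And>x. x \<in> A \<Longrightarrow> (\<lambda>k. f k x) \<longlonglongrightarrow> Z x"
  shows "(\<lambda>k. l2_dist A (f k) Z) \<longlonglongrightarrow> 0"
proof -
  have "(\<lambda>k. sqrt (\<Sum>x\<in>A. (cmod (f k x - Z x))\<^sup>2)) \<longlonglongrightarrow> sqrt (\<Sum>x\<in>A. (cmod (Z x - Z x))\<^sup>2)"
    by (intro tendsto_intros assms)
  then show ?thesis by (simp add: l2_dist_def l2_norm_def L2_set_def)
qed

text \<open>
  Bolzano--Weierstrass for functions on a finite set, by refining the subsequence at one point
  after another.
\<close>

lemma pointwise_bounded_imp_convergent_subseq:
  fixes f :: "nat \<Rightarrow> 'a \<Rightarrow> complex"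
  assumes "finite A" "\<And>x. x \<in> A \<Longrightarrow> bounded (range (\<lambda>k. f k x))"
  shows "\<exists>\<sigma>. strict_mono \<sigma> \<and> (\<forall>x\<in>A. convergent (\<lambda>k. f (\<sigma> k) x))"
  using assms
proof (induction A rule: finite_induct)
  case empty
  then show ?case by (auto intro: exI[of _ id] simp: strict_mono_def)
next
  case (insert a A)
  then obtain \<sigma> where \<sigma>: "strict_mono \<sigma>" "\<forall>x\<in>A. convergent (\<lambda>k. f (\<sigma> k) x)" by auto
  have "bounded (range (\<lambda>k. f (\<sigma> k) a))"
    using insert.prems[of a] by (auto intro: bounded_subset)
  then obtain l \<phi> where \<phi>: "strict_mono \<phi>" "((\<lambda>k. f (\<sigma> k) a) \<circ> \<phi>) \<longlonglongrightarrow> l"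
    using bounded_imp_convergent_subsequence by blast
  have "convergent (\<lambda>k. f ((\<sigma> \<circ> \<phi>) k) x)" if "x \<in> insert a A" for x
  proof (cases "x = a")
    case True
    then show ?thesis using \<phi> by (auto simp: convergent_def o_def)
  next
    case False
    then have "convergent (\<lambda>k. f (\<sigma> k) x)" using that \<sigma> by auto
    from convergent_subseq_convergent[OF this \<phi>(1)] show ?thesis by (simp add: o_def)
  qed
  moreover have "strict_mono (\<sigma> \<circ> \<phi>)" using \<sigma> \<phi> by (auto intro: strict_mono_o)
  ultimately show ?case by blast
qed

section \<open>Operators given by a matrix\<close>

definition kernel_op ::
    "'a set \<Rightarrow> 'b set \<Rightarrow> ('b \<Rightarrow> 'a \<Rightarrow> complex) \<Rightarrow> ('a \<Rightarrow> complex) \<Rightarrow> 'b \<Rightarrow> complex" where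
  "kernel_op A M K f = (\<lambda>m\<in>M. \<Sum>x\<in>A. K m x * f x)"

abbreviation kernel_adj ::
    "'a set \<Rightarrow> 'b set \<Rightarrow> ('b \<Rightarrow> 'a \<Rightarrow> complex) \<Rightarrow> ('b \<Rightarrow> complex) \<Rightarrow> 'a \<Rightarrow> complex" where
  "kernel_adj A M K \<equiv> kernel_op M A (\<lambda>x m. cnj (K m x))"

lemma kernel_op_in_cfuns: "kernel_op A M K f \<in> cfuns M"
  by (simp add: kernel_op_def cfuns_def PiE_def)

lemma kernel_op_diff:
  "m \<in> M \<Longrightarrow> kernel_op A M K (\<lambda>x. f x - g x) m = kernel_op A M K f m - kernel_op A M K g m"
  by (simp add: kernel_op_def right_diff_distrib sum_subtractf)

lemma cinner_on_kernel_op: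
  "cinner_on M (kernel_op A M K f) g = cinner_on A f (kernel_adj A M K g)"
proof -
  have "cinner_on M (kernel_op A M K f) g = (\<Sum>m\<in>M. \<Sum>x\<in>A. K m x * f x * cnj (g m))"
    by (simp add: cinner_on_def kernel_op_def sum_distrib_right)
  also have "\<dots> = (\<Sum>x\<in>A. \<Sum>m\<in>M. K m x * f x * cnj (g m))"
    by (rule sum.swap)
  also have "\<dots> = cinner_on A f (kernel_adj A M K g)"
    by (simp add: cinner_on_def kernel_op_def sum_distrib_left mult_ac)
  finally show ?thesis .
qed

text \<open>
  Testing the defining equation of the adjoint against unit vectors determines each value of the
  adjoint.
\<close>

lemma cadjoint_on_kernel_op:
  assumes "finite A"
  shows "cadjoint_on A M (kernel_op A M K) g = kernel_adj A M K g"
  unfolding cadjoint_on_def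
proof (rule the_equality)
  show "kernel_adj A M K g \<in> cfuns A \<and>
      (\<forall>f\<in>cfuns A. cinner_on M (kernel_op A M K f) g = cinner_on A f (kernel_adj A M K g))"
    by (simp add: kernel_op_in_cfuns cinner_on_kernel_op)
next
  fix h
  assume h: "h \<in> cfuns A \<and> (\<forall>f\<in>cfuns A. cinner_on M (kernel_op A M K f) g = cinner_on A f h)"
  show "h = kernel_adj A M K g"
  proof (rule PiE_ext)
    show "h \<in> A \<rightarrow>\<^sub>E UNIV" using h by (simp add: cfuns_def)
    show "kernel_adj A M K g \<in> A \<rightarrow>\<^sub>E UNIV" using kernel_op_in_cfuns by (simp add: cfuns_def)
    fix x assume x: "x \<in> A"
    define u :: "'a \<Rightarrow> complex" where "u = (\<lambda>y\<in>A. if y = x then 1 else 0)"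
    have u: "cinner_on A u h' = cnj (h' x)" for h'
    proof -
      have "cinner_on A u h' = (\<Sum>y\<in>A. if y = x then cnj (h' y) else 0)"
        by (auto simp: cinner_on_def u_def intro!: sum.cong)
      then show ?thesis using x assms by simp
    qed
    have "u \<in> cfuns A" by (simp add: u_def cfuns_def PiE_def)
    then have "cinner_on A u h = cinner_on A u (kernel_adj A M K g)"
      using h cinner_on_kernel_op by metis
    then show "h x = kernel_adj A M K g x" by (simp add: u)
  qed
qed

definition frobenius_norm :: "'a set \<Rightarrow> 'b set \<Rightarrow> ('b \<Rightarrow> 'a \<Rightarrow> complex) \<Rightarrow> real" where
  "frobenius_norm A M K = L2_set (\<lambda>m. l2_norm A (K m)) M"

lemma frobenius_norm_nonneg [simp]: "0 \<le> frobenius_norm A M K"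
  by (simp add: frobenius_norm_def)

lemma l2_norm_kernel_op_le: "l2_norm M (kernel_op A M K f) \<le> frobenius_norm A M K * l2_norm A f"
proof -
  have "l2_norm M (kernel_op A M K f) \<le> L2_set (\<lambda>m. l2_norm A (K m) * l2_norm A f) M"
    unfolding l2_norm_def[of M]
    by (rule L2_set_mono) (auto simp: kernel_op_def cmod_sum_mult_le)
  also have "\<dots> = frobenius_norm A M K * l2_norm A f"
    by (simp add: frobenius_norm_def L2_set_left_distrib)
  finally show ?thesis .
qed

section \<open>A single steepest-descent step\<close>

definition residual ::
    "'a set \<Rightarrow> 'b set \<Rightarrow> ('b \<Rightarrow> 'a \<Rightarrow> complex) \<Rightarrow> ('b \<Rightarrow> complex) \<Rightarrow> ('a \<Rightarrow> complex) \<Rightarrow> 'b \<Rightarrow> complex" where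
  "residual A M K g P = (\<lambda>m\<in>M. kernel_op A M K P m - g m)"

definition gradient ::
    "'a set \<Rightarrow> 'b set \<Rightarrow> ('b \<Rightarrow> 'a \<Rightarrow> complex) \<Rightarrow> ('b \<Rightarrow> complex) \<Rightarrow> ('a \<Rightarrow> complex) \<Rightarrow> 'a \<Rightarrow> complex" where
  "gradient A M K g P = kernel_adj A M K (residual A M K g P)"

definition step_size ::
    "'a set \<Rightarrow> 'b set \<Rightarrow> ('b \<Rightarrow> 'a \<Rightarrow> complex) \<Rightarrow> ('b \<Rightarrow> complex) \<Rightarrow> ('a \<Rightarrow> complex) \<Rightarrow> real" where
  "step_size A M K g P =
     (l2_norm A (gradient A M K g P))\<^sup>2 / (l2_norm M (kernel_op A M K (gradient A M K g P)))\<^sup>2"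

definition sd_step ::
    "'a set \<Rightarrow> 'b set \<Rightarrow> ('b \<Rightarrow> 'a \<Rightarrow> complex) \<Rightarrow> ('b \<Rightarrow> complex) \<Rightarrow> ('a \<Rightarrow> complex) \<Rightarrow> 'a \<Rightarrow> complex" where
  "sd_step A M K g P = (\<lambda>x\<in>A. P x - of_real (step_size A M K g P) * gradient A M K g P x)"

text \<open>
  At noise level zero a step is skipped exactly when the residual vanishes. Then the gradient
  vanishes as well, so the unconditional step does not move either.
\<close>

lemma lsdk_step_eq_sd_step:
  assumes "finite A" "finite M" "\<delta> (k mod r) = 0"
  shows "lsdk_step A M r (\<lambda>i. kernel_op A M (K i)) g \<delta> \<tau> k P
    = sd_step A M (K (k mod r)) (g (k mod r)) P"
proof -
  define j where "j = k mod r"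
  have res: "(\<lambda>m\<in>M. kernel_op A M (K j) P m - g j m) = residual A M (K j) (g j) P"
    by (simp add: residual_def)
  show ?thesis
  proof (cases "l2_norm M (residual A M (K j) (g j) P) > 0")
    case True
    then show ?thesis
      using assms by (simp add: lsdk_step_def Let_def res cadjoint_on_kernel_op sd_step_def
          step_size_def gradient_def j_def[symmetric])
  next
    case False
    then have "l2_norm M (residual A M (K j) (g j) P) = 0"
      using l2_norm_nonneg by (metis less_eq_real_def)
    then have "\<forall>m\<in>M. residual A M (K j) (g j) P m = 0"
      using assms by (simp add: l2_norm_eq_0_iff)
    then have "\<forall>x\<in>A. gradient A M (K j) (g j) P x = 0"
      by (simp add: gradient_def kernel_op_def)
    then show ?thesis
      using assms False by (auto simp: lsdk_step_def Let_def res sd_step_def j_def[symmetric])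
  qed
qed

context
  fixes A :: "'a set" and M :: "'b set" and K :: "'b \<Rightarrow> 'a \<Rightarrow> complex" and g :: "'b \<Rightarrow> complex"
    and P Z :: "'a \<Rightarrow> complex"
  assumes fin: "finite A" "finite M"
    and sol: "kernel_op A M K Z = g"
begin

private abbreviation (input) "res \<equiv> residual A M K g P"
private abbreviation (input) "s \<equiv> gradient A M K g P"
private abbreviation (input) "\<alpha> \<equiv> step_size A M K g P"
private abbreviation (input) "T \<equiv> kernel_op A M K"

private lemma cinner_error_gradient: "Re (cinner_on A (\<lambda>x. P x - Z x) s) = (l2_norm M res)\<^sup>2"
proof -
  have "cinner_on A (\<lambda>x. P x - Z x) s = cinner_on M (T (\<lambda>x. P x - Z x)) res"
    by (simp add: gradient_def cinner_on_kernel_op)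
  also have "\<dots> = cinner_on M res res"
    by (rule cinner_on_cong) (auto simp: residual_def kernel_op_diff sol[symmetric])
  finally show ?thesis by (simp add: l2_norm_power2_eq_cinner)
qed

private lemma gradient_power2_le: "(l2_norm A s)\<^sup>2 \<le> l2_norm M (T s) * l2_norm M res"
proof -
  have "(l2_norm A s)\<^sup>2 = Re (cinner_on M (T s) res)"
    by (simp add: l2_norm_power2_eq_cinner cinner_on_kernel_op gradient_def)
  also have "\<dots> \<le> cmod (cinner_on M (T s) res)" by (rule complex_Re_le_cmod)
  also have "\<dots> \<le> l2_norm M (T s) * l2_norm M res" by (rule Cauchy_Schwarz_cinner_on)
  finally show ?thesis .
qed

private lemma step_size_nonneg: "0 \<le> \<alpha>"
  by (simp add: step_size_def)

private lemma step_size_gradient_le: "\<alpha> * (l2_norm A s)\<^sup>2 \<le> (l2_norm M res)\<^sup>2"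
  \<comment> \<open>If \<open>T s = 0\<close>, the quotient \<open>\<alpha>\<close> is a division by zero, which is zero.\<close>
proof (cases "l2_norm M (T s) = 0")
  case False
  have "((l2_norm A s)\<^sup>2)\<^sup>2 \<le> (l2_norm M (T s) * l2_norm M res)\<^sup>2"
    using gradient_power2_le by (rule power_mono) simp
  then have "((l2_norm A s)\<^sup>2)\<^sup>2 / (l2_norm M (T s))\<^sup>2 \<le> (l2_norm M res)\<^sup>2"
    using False by (subst pos_divide_le_eq) (simp_all add: power_mult_distrib mult.commute)
  then show ?thesis by (simp add: step_size_def power2_eq_square)
qed (simp add: step_size_def)

private lemma sd_step_decrease:
  "\<alpha> * (l2_norm M res)\<^sup>2 \<le> (l2_dist A P Z)\<^sup>2 - (l2_dist A (sd_step A M K g P) Z)\<^sup>2"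
proof -
  have "l2_dist A (sd_step A M K g P) Z = l2_norm A (\<lambda>x. (P x - Z x) - of_real \<alpha> * s x)"
    unfolding l2_dist_def by (rule l2_norm_cong) (simp add: sd_step_def)
  then have "(l2_dist A (sd_step A M K g P) Z)\<^sup>2
      = (l2_dist A P Z)\<^sup>2 - 2 * \<alpha> * (l2_norm M res)\<^sup>2 + \<alpha> * (\<alpha> * (l2_norm A s)\<^sup>2)"
    unfolding l2_norm_diff_scaled cinner_error_gradient
    by (simp only: l2_norm_diff_scaled cinner_error_gradient l2_dist_def) (simp add: power2_eq_square)
  then show ?thesis
    using mult_left_mono[OF step_size_gradient_le step_size_nonneg] by simp
qed

lemma sd_step_length:
  "(l2_dist A (sd_step A M K g P) P)\<^sup>2
    \<le> (l2_dist A P Z)\<^sup>2 - (l2_dist A (sd_step A M K g P) Z)\<^sup>2"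
proof -
  have "l2_dist A P (sd_step A M K g P) = l2_norm A (\<lambda>x. of_real \<alpha> * s x)"
    unfolding l2_dist_def by (rule l2_norm_cong) (simp add: sd_step_def)
  then have "(l2_dist A (sd_step A M K g P) P)\<^sup>2 = \<alpha> * (\<alpha> * (l2_norm A s)\<^sup>2)"
    by (simp only: l2_dist_commute[of A _ P] l2_norm_scaled) (simp add: power2_eq_square)
  also have "\<dots> \<le> \<alpha> * (l2_norm M res)\<^sup>2"
    using step_size_gradient_le step_size_nonneg by (rule mult_left_mono)
  finally show ?thesis using sd_step_decrease by linarith
qed

text \<open>
  A nonzero residual forces \<open>s \<noteq> 0\<close> and \<open>T s \<noteq> 0\<close>: it lies in the range of \<open>T\<close>, on which
  the adjoint is injective. So the quotient defining \<open>\<alpha>\<close> is genuine and is at least the inverse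
  square of any bound for \<open>T\<close>.
\<close>

lemma sd_step_residual:
  "(l2_norm M res)\<^sup>2 \<le> (frobenius_norm A M K)\<^sup>2
      * ((l2_dist A P Z)\<^sup>2 - (l2_dist A (sd_step A M K g P) Z)\<^sup>2)"
proof -
  let ?C = "frobenius_norm A M K"
  have "(l2_norm M res)\<^sup>2 \<le> ?C\<^sup>2 * (\<alpha> * (l2_norm M res)\<^sup>2)"
  proof (cases "l2_norm M res = 0")
    case False
    have "l2_norm A s \<noteq> 0"
    proof
      assume "l2_norm A s = 0"
      then have "Re (cinner_on A (\<lambda>x. P x - Z x) s) = 0"
        using fin by (simp add: l2_norm_eq_0_iff cinner_on_def)
      then show False using False by (simp add: cinner_error_gradient)
    qed
    then have "l2_norm M (T s) \<noteq> 0" using gradient_power2_le by auto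
    moreover have "(l2_norm M (T s))\<^sup>2 \<le> (?C * l2_norm A s)\<^sup>2"
      using l2_norm_kernel_op_le by (rule power_mono) simp
    ultimately have "1 \<le> ?C\<^sup>2 * \<alpha>"
      by (simp add: step_size_def field_simps power_mult_distrib)
    then show ?thesis
      using mult_right_mono[of 1 "?C\<^sup>2 * \<alpha>" "(l2_norm M res)\<^sup>2"] by (simp add: mult_ac)
  qed simp
  also have "\<dots> \<le> ?C\<^sup>2 * ((l2_dist A P Z)\<^sup>2 - (l2_dist A (sd_step A M K g P) Z)\<^sup>2)"
    using sd_step_decrease by (rule mult_left_mono) simp
  finally show ?thesis .
qed

end

section \<open>Convergence of the cyclic iteration\<close>

locale cyclic_steepest_descent =
  fixes A :: "'a set" and M :: "'b set" and r :: nat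
    and K :: "nat \<Rightarrow> 'b \<Rightarrow> 'a \<Rightarrow> complex" and g :: "nat \<Rightarrow> 'b \<Rightarrow> complex"
    and P :: "nat \<Rightarrow> 'a \<Rightarrow> complex" and Z0 :: "'a \<Rightarrow> complex"
  assumes fin: "finite A" "finite M" and r_pos: "0 < r"
    and P_Suc: "P (Suc k) = sd_step A M (K (k mod r)) (g (k mod r)) (P k)"
    and solvable: "i < r \<Longrightarrow> kernel_op A M (K i) Z0 = g i"
begin

abbreviation used_residual :: "nat \<Rightarrow> 'b \<Rightarrow> complex" where
  "used_residual k \<equiv> residual A M (K (k mod r)) (g (k mod r)) (P k)"

lemma decseq_dist_solution:
  assumes "\<And>i. i < r \<Longrightarrow> kernel_op A M (K i) Z = g i"
  shows "decseq (\<lambda>k. l2_dist A (P k) Z)"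
proof (rule decseq_SucI)
  fix k
  have "(l2_dist A (P (Suc k)) (P k))\<^sup>2 \<le> (l2_dist A (P k) Z)\<^sup>2 - (l2_dist A (P (Suc k)) Z)\<^sup>2"
    unfolding P_Suc using r_pos assms by (intro sd_step_length fin) simp
  then have "(l2_dist A (P (Suc k)) Z)\<^sup>2 \<le> (l2_dist A (P k) Z)\<^sup>2"
    using zero_le_power2[of "l2_dist A (P (Suc k)) (P k)"] by linarith
  then show "l2_dist A (P (Suc k)) Z \<le> l2_dist A (P k) Z"
    by (rule power2_le_imp_le) simp
qed

definition drop_sq :: "nat \<Rightarrow> real" where
  "drop_sq k = (l2_dist A (P k) Z0)\<^sup>2 - (l2_dist A (P (Suc k)) Z0)\<^sup>2"

lemma drop_sq_tendsto_0: "drop_sq \<longlonglongrightarrow> 0"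
proof -
  have "decseq (\<lambda>k. l2_dist A (P k) Z0)" by (rule decseq_dist_solution) (rule solvable)
  then obtain L where L: "(\<lambda>k. l2_dist A (P k) Z0) \<longlonglongrightarrow> L"
    using decseq_convergent[of "\<lambda>k. l2_dist A (P k) Z0" 0] by auto
  have "(\<lambda>k. (l2_dist A (P k) Z0)\<^sup>2 - (l2_dist A (P (Suc k)) Z0)\<^sup>2) \<longlonglongrightarrow> L\<^sup>2 - L\<^sup>2"
    by (intro tendsto_intros L LIMSEQ_Suc)
  then show ?thesis by (simp add: drop_sq_def[abs_def])
qed

lemma tendsto_0_if_power2_le:
  fixes a :: "nat \<Rightarrow> real"
  assumes "\<And>k. (a k)\<^sup>2 \<le> c * drop_sq k"
  shows "a \<longlonglongrightarrow> 0"
proof -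
  have "(\<lambda>k. c * drop_sq k) \<longlonglongrightarrow> 0"
    using tendsto_mult_right_zero[OF drop_sq_tendsto_0] .
  then have "(\<lambda>k. (a k)\<^sup>2) \<longlonglongrightarrow> 0"
    using tendsto_sandwich[of "\<lambda>_. 0" "\<lambda>k. (a k)\<^sup>2" sequentially "\<lambda>k. c * drop_sq k" 0] assms by simp
  then have "(\<lambda>k. sqrt ((a k)\<^sup>2)) \<longlonglongrightarrow> sqrt 0"
    by (rule tendsto_real_sqrt)
  then show ?thesis by (simp add: tendsto_rabs_zero_iff)
qed

lemma step_tendsto_0: "(\<lambda>k. l2_dist A (P (Suc k)) (P k)) \<longlonglongrightarrow> 0"
proof (rule tendsto_0_if_power2_le[where c = 1])
  fix k
  show "(l2_dist A (P (Suc k)) (P k))\<^sup>2 \<le> 1 * drop_sq k"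
    unfolding drop_sq_def P_Suc mult_1 using r_pos solvable by (intro sd_step_length fin) simp
qed

lemma shifted_step_tendsto_0: "(\<lambda>k. l2_dist A (P (k + j)) (P k)) \<longlonglongrightarrow> 0"
proof (induction j)
  case 0
  show ?case by (simp add: l2_dist_def l2_norm_def L2_set_def)
next
  case (Suc j)
  have "(\<lambda>k. l2_dist A (P (Suc (k + j))) (P (k + j)) + l2_dist A (P (k + j)) (P k)) \<longlonglongrightarrow> 0 + 0"
    (is "?bound \<longlonglongrightarrow> _")
    using LIMSEQ_ignore_initial_segment[OF step_tendsto_0, of j] Suc
    by (intro tendsto_add) (simp_all add: add.commute)
  then have bound: "?bound \<longlonglongrightarrow> 0" by simp
  have le: "l2_dist A (P (k + Suc j)) (P k) \<le> ?bound k" for k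
    using l2_dist_triangle by simp
  show ?case
    by (rule tendsto_sandwich[OF _ _ tendsto_const bound]) (use le in simp_all)
qed

lemma used_residual_tendsto_0: "(\<lambda>k. l2_norm M (used_residual k)) \<longlonglongrightarrow> 0"
proof (rule tendsto_0_if_power2_le)
  fix k
  let ?C = "\<lambda>i. (frobenius_norm A M (K i))\<^sup>2"
  have j: "k mod r < r" using r_pos by simp
  have nonneg: "0 \<le> drop_sq k"
    using sd_step_length[OF fin solvable[OF j], of "P k"]
      zero_le_power2[of "l2_dist A (P (Suc k)) (P k)"]
    unfolding drop_sq_def P_Suc by linarith
  have "(l2_norm M (used_residual k))\<^sup>2 \<le> ?C (k mod r) * drop_sq k"
    unfolding drop_sq_def P_Suc by (intro sd_step_residual fin solvable j)
  also have "\<dots> \<le> (\<Sum>i<r. ?C i) * drop_sq k"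
    using j nonneg by (intro mult_right_mono member_le_sum) auto
  finally show "(l2_norm M (used_residual k))\<^sup>2 \<le> (\<Sum>i<r. ?C i) * drop_sq k" .
qed

text \<open>
  Equation \<open>i\<close> is used at some time within the next \<open>r\<close> steps, where its residual is small, and
  the iterate has hardly moved until then.
\<close>

lemma residual_tendsto_0:
  assumes i: "i < r"
  shows "(\<lambda>k. l2_norm M (residual A M (K i) (g i) (P k))) \<longlonglongrightarrow> 0"
proof -
  let ?C = "frobenius_norm A M (K i)"
  define bound where "bound = (\<lambda>k. \<Sum>j<r. l2_norm M (used_residual (k + j))
      + ?C * l2_dist A (P (k + j)) (P k))"
  have "bound \<longlonglongrightarrow> (\<Sum>j<r. 0 + ?C * 0)"
    unfolding bound_def using LIMSEQ_ignore_initial_segment[OF used_residual_tendsto_0]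
    by (intro tendsto_intros shifted_step_tendsto_0)
  then have lim: "bound \<longlonglongrightarrow> 0" by simp
  have le: "l2_norm M (residual A M (K i) (g i) (P k)) \<le> bound k" for k
  proof -
    \<comment> \<open>The first time from \<open>k\<close> on that is congruent to \<open>i\<close> modulo \<open>r\<close>.\<close>
    define j where "j = (i + r - k mod r) mod r"
    have j: "j < r" using r_pos by (simp add: j_def)
    have "(k + j) mod r = (k mod r + (i + r - k mod r)) mod r"
      by (simp add: j_def mod_simps)
    also have "k mod r + (i + r - k mod r) = i + r"
      using mod_less_divisor[OF r_pos, of k] by linarith
    also have "(i + r) mod r = i" using i by simp
    finally have kj: "(k + j) mod r = i" .
    have "l2_norm M (residual A M (K i) (g i) (P k))
        = l2_norm M (\<lambda>m. used_residual (k + j) m + kernel_op A M (K i) (\<lambda>x. P k x - P (k + j) x) m)"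
      by (rule l2_norm_cong) (simp add: kj residual_def kernel_op_diff)
    also have "\<dots> \<le> l2_norm M (used_residual (k + j))
        + l2_norm M (kernel_op A M (K i) (\<lambda>x. P k x - P (k + j) x))"
      by (rule l2_norm_triangle)
    also have "\<dots> \<le> l2_norm M (used_residual (k + j)) + ?C * l2_dist A (P (k + j)) (P k)"
      unfolding l2_dist_commute[of A "P (k + j)"] unfolding l2_dist_def
      by (intro add_left_mono l2_norm_kernel_op_le)
    also have "\<dots> \<le> bound k"
      unfolding bound_def using j
      by (intro member_le_sum[where f = "\<lambda>j. l2_norm M (used_residual (k + j))
            + ?C * l2_dist A (P (k + j)) (P k)"]) auto
    finally show ?thesis .
  qed
  show ?thesis
    by (rule tendsto_sandwich[OF _ _ tendsto_const lim]) (auto simp: le)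
qed

lemma bounded_at_point:
  assumes "x \<in> A"
  shows "bounded (range (\<lambda>k. P k x))"
proof -
  have "decseq (\<lambda>k. l2_dist A (P k) Z0)" by (rule decseq_dist_solution) (rule solvable)
  then have le: "l2_dist A (P k) Z0 \<le> l2_dist A (P 0) Z0" for k by (rule decseqD) simp
  have "dist (Z0 x) (P k x) \<le> l2_dist A (P 0) Z0" for k
    using cmod_le_l2_norm[OF fin(1) assms, of "\<lambda>x. P k x - Z0 x"] le[of k]
    by (simp add: l2_dist_def dist_norm norm_minus_commute)
  then show ?thesis unfolding bounded_def by blast
qed

theorem converges_to_solution:
  "\<exists>Z\<in>cfuns A. (\<forall>i<r. kernel_op A M (K i) Z = g i) \<and> (\<lambda>k. l2_dist A (P k) Z) \<longlonglongrightarrow> 0"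
proof -
  obtain \<sigma> where \<sigma>: "strict_mono \<sigma>" "\<forall>x\<in>A. convergent (\<lambda>k. P (\<sigma> k) x)"
    using pointwise_bounded_imp_convergent_subseq[of A P] fin bounded_at_point by blast
  define Z where "Z = (\<lambda>x\<in>A. lim (\<lambda>k. P (\<sigma> k) x))"
  have lim_x: "(\<lambda>k. P (\<sigma> k) x) \<longlonglongrightarrow> Z x" if "x \<in> A" for x
    using \<sigma>(2) that by (simp add: Z_def convergent_LIMSEQ_iff)
  have sol: "kernel_op A M (K i) Z = g i" if i: "i < r" for i
  proof (rule PiE_ext)
    show "kernel_op A M (K i) Z \<in> M \<rightarrow>\<^sub>E UNIV"
      using kernel_op_in_cfuns by (simp add: cfuns_def)
    show "g i \<in> M \<rightarrow>\<^sub>E UNIV"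
      using kernel_op_in_cfuns solvable[OF i] by (metis cfuns_def)
    fix m assume m: "m \<in> M"
    have "(\<lambda>k. l2_norm M (residual A M (K i) (g i) (P (\<sigma> k)))) \<longlonglongrightarrow> 0"
      using LIMSEQ_subseq_LIMSEQ[OF residual_tendsto_0[OF i] \<sigma>(1)] by (simp add: o_def)
    then have "(\<lambda>k. residual A M (K i) (g i) (P (\<sigma> k)) m) \<longlonglongrightarrow> 0"
      by (rule Lim_null_comparison[rotated]) (simp add: cmod_le_l2_norm fin m)
    then have "(\<lambda>k. (\<Sum>x\<in>A. K i m x * P (\<sigma> k) x) - g i m) \<longlonglongrightarrow> 0"
      using m by (simp add: residual_def kernel_op_def)
    moreover have "(\<lambda>k. (\<Sum>x\<in>A. K i m x * P (\<sigma> k) x) - g i m) \<longlonglongrightarrow> (\<Sum>x\<in>A. K i m x * Z x) - g i m"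
      by (intro tendsto_intros lim_x)
    ultimately have "(\<Sum>x\<in>A. K i m x * Z x) - g i m = 0"
      using LIMSEQ_unique by blast
    then show "kernel_op A M (K i) Z m = g i m" using m by (simp add: kernel_op_def)
  qed
  have dec: "decseq (\<lambda>k. l2_dist A (P k) Z)" by (rule decseq_dist_solution) (rule sol)
  then obtain L where L: "(\<lambda>k. l2_dist A (P k) Z) \<longlonglongrightarrow> L"
    using decseq_convergent[of "\<lambda>k. l2_dist A (P k) Z" 0] by auto
  have "(\<lambda>k. l2_dist A (P (\<sigma> k)) Z) \<longlonglongrightarrow> L"
    using LIMSEQ_subseq_LIMSEQ[OF L \<sigma>(1)] by (simp add: o_def)
  moreover have "(\<lambda>k. l2_dist A (P (\<sigma> k)) Z) \<longlonglongrightarrow> 0"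
    by (rule l2_dist_tendsto_0) (rule lim_x)
  ultimately have "L = 0" using LIMSEQ_unique by blast
  moreover have "Z \<in> cfuns A" by (simp add: Z_def cfuns_def PiE_def)
  ultimately show ?thesis using L sol by blast
qed

end

theorem lsdk_converges:
  assumes "finite A" "finite M" "0 < r"
    and "\<And>i. i < r \<Longrightarrow> \<delta> i = 0"
    and "\<And>i. i < r \<Longrightarrow> kernel_op A M (K i) Z0 = g i"
  shows "\<exists>Z\<in>cfuns A. (\<forall>i<r. kernel_op A M (K i) Z = g i) \<and>
    (\<lambda>k. l2_dist A (lsdk A M r (\<lambda>i. kernel_op A M (K i)) g \<delta> \<tau> P0 k) Z) \<longlonglongrightarrow> 0"
proof -
  interpret cyclic_steepest_descent A M r K g
      "lsdk A M r (\<lambda>i. kernel_op A M (K i)) g \<delta> \<tau> P0" Z0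
    by unfold_locales (use assms in \<open>auto simp: lsdk_step_eq_sd_step\<close>)
  show ?thesis by (rule converges_to_solution)
qed

section \<open>The MRI operators\<close>

definition mri_kernel ::
    "nat \<Rightarrow> nat \<Rightarrow> (pixel \<Rightarrow> nat) \<Rightarrow> nat \<Rightarrow> (nat \<Rightarrow> pixel \<Rightarrow> complex) \<Rightarrow>
     (nat \<Rightarrow> nat \<Rightarrow> complex) \<Rightarrow> nat \<Rightarrow> pixel \<Rightarrow> pixel \<Rightarrow> complex" where
  "mri_kernel p_hor p_ver idx b_num Bas b i m x =
     (\<Sum>n = 1..b_num. b i n * Bas n x *
        exp (- 2 * of_real pi * \<i> * of_nat (idx x) * of_nat (idx m) / of_nat (p_hor * p_ver)))"

lemma mri_op_eq_kernel_op:
  assumes "M \<subseteq> pixels p_hor p_ver"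
  shows "mri_op p_hor p_ver idx M b_num Bas b i
    = kernel_op (pixels p_hor p_ver) M (mri_kernel p_hor p_ver idx b_num Bas b i)"
proof (rule ext)
  fix f
  let ?B = "pixels p_hor p_ver"
  let ?E = "\<lambda>x m. exp (- 2 * of_real pi * \<i> * of_nat (idx x) * of_nat (idx m) / of_nat (p_hor * p_ver))
    :: complex"
  have "(\<Sum>n = 1..b_num. b i n * restrict (dft p_hor p_ver idx (\<lambda>x\<in>?B. f x * Bas n x)) M m)
      = (\<Sum>x\<in>?B. mri_kernel p_hor p_ver idx b_num Bas b i m x * f x)" if m: "m \<in> M" for m
  proof -
    have "dft p_hor p_ver idx (\<lambda>x\<in>?B. f x * Bas n x) m = (\<Sum>x\<in>?B. f x * Bas n x * ?E x m)" for n
      using m assms by (auto simp: dft_def)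
    then have "(\<Sum>n = 1..b_num. b i n * restrict (dft p_hor p_ver idx (\<lambda>x\<in>?B. f x * Bas n x)) M m)
        = (\<Sum>n = 1..b_num. \<Sum>x\<in>?B. b i n * (f x * Bas n x * ?E x m))"
      using m by (simp add: sum_distrib_left)
    also have "\<dots> = (\<Sum>x\<in>?B. \<Sum>n = 1..b_num. b i n * (f x * Bas n x * ?E x m))"
      by (rule sum.swap)
    also have "\<dots> = (\<Sum>x\<in>?B. mri_kernel p_hor p_ver idx b_num Bas b i m x * f x)"
      unfolding mri_kernel_def sum_distrib_right
      by (intro sum.cong refl) (simp only: mult_ac)
    finally show ?thesis .
  qed
  then show "mri_op p_hor p_ver idx M b_num Bas b i f
      = kernel_op ?B M (mri_kernel p_hor p_ver idx b_num Bas b i) f"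
    unfolding mri_op_def kernel_op_def by (rule restrict_ext)
qed

theorem theorem4p2:
  fixes p_hor p_ver r_num b_num :: nat
    and idx :: "pixel \<Rightarrow> nat"
    and M :: "pixel set"
    and Bas :: "nat \<Rightarrow> pixel \<Rightarrow> complex"
    and b :: "nat \<Rightarrow> nat \<Rightarrow> complex"
    and data data_\<delta> :: "nat \<Rightarrow> pixel \<Rightarrow> complex"
    and \<delta> :: "nat \<Rightarrow> real"
    and \<tau> \<rho> :: real
    and P0 :: "pixel \<Rightarrow> complex"
  defines "B \<equiv> pixels p_hor p_ver"
    and "F \<equiv> mri_op p_hor p_ver idx M b_num Bas b"
  assumes "p_hor > 0" and "p_ver > 0" and "r_num > 0" and "b_num > 0"
    and "bij_betw idx B {0..<p_hor * p_ver}"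
    and "M \<subseteq> B"
    and "\<And>n. n \<in> {1..b_num} \<Longrightarrow> Bas n \<in> cfuns B"
    and "\<tau> > 2" and "\<rho> > 0"
    and "P0 \<in> cfuns B"
    and "\<And>i. i < r_num \<Longrightarrow> data i \<in> cfuns M"
    and "\<exists>Pstar\<in>cfuns B. l2_dist B Pstar P0 \<le> \<rho> / 2 \<and> (\<forall>i<r_num. F i Pstar = data i)"
    and "\<And>i. i < r_num \<Longrightarrow> data_\<delta> i = data i"
    and "\<And>i. i < r_num \<Longrightarrow> \<delta> i = 0"
  shows "\<exists>P\<in>cfuns B. (\<forall>i<r_num. F i P = data i) \<and>
           (\<lambda>k. l2_dist B (lsdk B M r_num F data_\<delta> \<delta> \<tau> P0 k) P) \<longlonglongrightarrow> 0"
proof -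
  have finB: "finite B" by (simp add: B_def pixels_def)
  moreover have "finite M" using finB assms(8) by (rule finite_subset[rotated])
  moreover have F: "F = (\<lambda>i. kernel_op B M (mri_kernel p_hor p_ver idx b_num Bas b i))"
    using assms(8) by (auto simp: F_def B_def mri_op_eq_kernel_op)
  moreover obtain Pstar where "\<forall>i<r_num. F i Pstar = data i" using assms(14) by blast
  ultimately have "\<exists>P\<in>cfuns B. (\<forall>i<r_num. F i P = data_\<delta> i) \<and>
      (\<lambda>k. l2_dist B (lsdk B M r_num F data_\<delta> \<delta> \<tau> P0 k) P) \<longlonglongrightarrow> 0"
    using lsdk_converges[of B M r_num \<delta> "mri_kernel p_hor p_ver idx b_num Bas b" Pstar data_\<delta> \<tau> P0]
      assms(5,15,16) by simp
  then show ?thesis using assms(15) by simp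
qed

end
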